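(* Let $\mathbf{s}=(s_1,\ldots,s_n)$ be a sequence of positive integers with $\gcd(s_i,s_{i+1})=1$ for $1\leq i<n$. Then the $h^*$-vector of $\mathcal{R}_n^{(\mathbf{s})}$ is symmetric if and only if $\mathbf{s}$ is $\mathbf{u}$-generated by some sequence $\mathbf{u}=(u_1,\ldots,u_{n-1})$ of positive integers.
   Context: A sequence $\mathbf{s}$ is $\mathbf{u}$-generated by a sequence $\mathbf{u}$ of positive integers if $s_2=u_1s_1-1$ and $s_{i+1}=u_is_i-s_{i-1}$ for $i>1$. Let $\mathcal{C}_n^{(\mathbf{s})}=\{\lambda\in\mathbb{R}^n: 0\leq\lambda_1/s_1\leq\cdots\leq\lambda_n/s_n\}$, $\mathcal{L}_n^{(\mathbf{s})}=\mathcal{C}_n^{(\mathbf{s})}\cap\mathbb{Z}^n$, and $\mathcal{R}_n^{(\mathbf{s})}=\{\lambda\in\mathcal{C}_n^{(\mathbf{s})}:\lambda_n\leq1\}$. For integers $t\geq0$ let $i(\mathcal{R}_n^{(\mathbf{s})},t)=|\{\lambda\in\mathcal{L}_n^{(\mathbf{s})}:\lambda_n\leq t\}|$ and $\mathcal{E}_n^{(\mathbf{s})}(x)=\sum_{t\geq0}i(\mathcal{R}_n^{(\mathbf{s})},t)x^t$. It is known that $Q_n^{(\mathbf{s})}(x):=(1-x^{s_n})^{n+1}\mathcal{E}_n^{(\mathbf{s})}(x)$ is a polynomial; its coefficient sequence is the $h^*$-vector of $\mathcal{R}_n^{(\mathbf{s})}$, which is called symmetric if it reads the same from left to right as from right to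 left. *)

theory Defs
  imports
    Complex_Main
    "HOL-Library.FuncSet"
    "HOL-Computational_Algebra.Computational_Algebra"
begin

text \<open>
  Sequences of length \<open>n\<close> are functions on \<open>nat\<close> read at the indices \<open>1, \<dots>, n\<close> only.
  The space of real \<open>n\<close>-tuples is \<open>{1..n} \<rightarrow>\<^sub>E UNIV\<close>: extensionality makes points
  of it correspond one-to-one to tuples, which matters for counting them.
\<close>

text \<open>
  For \<open>n = 1\<close> there is no recurrence to satisfy. The equations are stated in \<open>int\<close>
  because subtraction on \<open>nat\<close> truncates.
\<close>
definition u_generated :: "nat \<Rightarrow> (nat \<Rightarrow> nat) \<Rightarrow> (nat \<Rightarrow> nat) \<Rightarrow> bool" where
  "u_generated n s u \<longleftrightarrow>
     (\<forall>i. 1 \<le> i \<and> i < n \<longrightarrow> u i > 0) \<and>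
     (1 < n \<longrightarrow> int (s 2) = int (u 1) * int (s 1) - 1) \<and>
     (\<forall>i. 1 < i \<and> i < n \<longrightarrow> int (s (i + 1)) = int (u i) * int (s i) - int (s (i - 1)))"

definition lecture_hall_cone :: "nat \<Rightarrow> (nat \<Rightarrow> nat) \<Rightarrow> (nat \<Rightarrow> real) set" where
  "lecture_hall_cone n s =
     {l \<in> {1..n} \<rightarrow>\<^sub>E UNIV.
        0 \<le> l 1 / real (s 1) \<and>
        (\<forall>i. 1 \<le> i \<and> i < n \<longrightarrow> l i / real (s i) \<le> l (i + 1) / real (s (i + 1)))}"

definition lecture_hall_lattice :: "nat \<Rightarrow> (nat \<Rightarrow> nat) \<Rightarrow> (nat \<Rightarrow> real) set" where
  "lecture_hall_lattice n s = lecture_hall_cone n s \<inter> ({1..n} \<rightarrow>\<^sub>E \<int>)"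

definition lecture_hall_polytope :: "nat \<Rightarrow> (nat \<Rightarrow> nat) \<Rightarrow> (nat \<Rightarrow> real) set" where
  "lecture_hall_polytope n s = {l \<in> lecture_hall_cone n s. l n \<le> 1}"

definition ehrhart_count :: "nat \<Rightarrow> (nat \<Rightarrow> nat) \<Rightarrow> nat \<Rightarrow> nat" where
  "ehrhart_count n s t = card {l \<in> lecture_hall_lattice n s. l n \<le> real t}"

text \<open>
  The counted points are the lattice points of the dilate by \<open>t\<close> of the polytope.
\<close>
lemma lattice_points_dilate:
  assumes n: "n \<ge> 1" and s: "\<And>i. 1 \<le> i \<Longrightarrow> i \<le> n \<Longrightarrow> s i > 0"
  shows "{l \<in> lecture_hall_lattice n s. l n \<le> real t} =
    (\<lambda>m. restrict (\<lambda>i. real t * m i) {1..n}) ` lecture_hall_polytope n s \<inter> ({1..n} \<rightarrow>\<^sub>E \<int>)"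
    (is "?A = ?B")
proof (intro equalityI subsetI)
  fix l assume l: "l \<in> ?A"
  hence ext: "l \<in> {1..n} \<rightarrow>\<^sub>E \<int>" and l1: "0 \<le> l 1 / real (s 1)"
    and chain: "\<And>i. 1 \<le> i \<Longrightarrow> i < n \<Longrightarrow> l i / real (s i) \<le> l (i + 1) / real (s (i + 1))"
    and ln: "l n \<le> real t"
    by (auto simp: lecture_hall_lattice_def lecture_hall_cone_def)
  show "l \<in> ?B"
  proof (cases "t = 0")
    case False
    let ?m = "restrict (\<lambda>i. l i / real t) {1..n}"
    have "?m \<in> lecture_hall_polytope n s"
    proof -
      have "0 \<le> l 1 / real t / real (s 1)"
        using l1 by (metis divide_nonneg_nonneg divide_divide_eq_left mult.commute of_nat_0_le_iff)
      moreover have "l i / real t / real (s i) \<le> l (i + 1) / real t / real (s (i + 1))"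
        if "1 \<le> i" "i < n" for i
        using divide_right_mono[OF chain[OF that], of "real t"]
        by (simp add: mult.commute)
      moreover have "l n / real t \<le> 1" using ln False by simp
      ultimately show ?thesis
        using n by (simp add: lecture_hall_polytope_def lecture_hall_cone_def)
    qed
    moreover have "l = restrict (\<lambda>i. real t * ?m i) {1..n}"
      using ext False by (auto simp: fun_eq_iff PiE_def extensional_def restrict_def)
    ultimately show ?thesis using ext by blast
  next
    case True
    have nonneg: "0 \<le> l i / real (s i)" if "1 \<le> i" "i \<le> n" for i
      using that
    proof (induction i rule: dec_induct)
      case base
      show ?case by (fact l1)
    next
      case (step k)
      thus ?case using chain[of k] by simp
    qed
    have below: "l i / real (s i) \<le> l n / real (s n)" if "i \<le> n" "1 \<le> i" for i
      using that
    proof (induction i rule: inc_induct)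
      case base
      show ?case by simp
    next
      case (step k)
      thus ?case using chain[of k] by simp
    qed
    have zero: "l i = 0" if "1 \<le> i" "i \<le> n" for i
    proof -
      have "l n / real (s n) \<le> 0"
        using ln True by (simp add: divide_nonpos_nonneg)
      hence "l i / real (s i) = 0" using nonneg[OF that] below[of i] that by linarith
      thus ?thesis using s[OF that] by simp
    qed
    let ?z = "restrict (\<lambda>i. 0 :: real) {1..n}"
    have "?z \<in> lecture_hall_polytope n s"
      using n by (auto simp: lecture_hall_polytope_def lecture_hall_cone_def)
    moreover have "l = restrict (\<lambda>i. real t * ?z i) {1..n}"
      using ext zero by (auto simp: fun_eq_iff PiE_def extensional_def restrict_def)
    ultimately show ?thesis using ext by blast
  qed
next
  fix l assume l: "l \<in> ?B"
  then obtain m where m: "m \<in> lecture_hall_polytope n s"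
    and eq: "l = restrict (\<lambda>i. real t * m i) {1..n}" and ext: "l \<in> {1..n} \<rightarrow>\<^sub>E \<int>" by blast
  have m1: "0 \<le> m 1 / real (s 1)" and mn: "m n \<le> 1"
    and chain: "\<And>i. 1 \<le> i \<Longrightarrow> i < n \<Longrightarrow> m i / real (s i) \<le> m (i + 1) / real (s (i + 1))"
    using m by (auto simp: lecture_hall_polytope_def lecture_hall_cone_def)
  have "0 \<le> real t * (m 1 / real (s 1))" using m1 by (intro mult_nonneg_nonneg) auto
  moreover have "real t * (m i / real (s i)) \<le> real t * (m (i + 1) / real (s (i + 1)))"
    if "1 \<le> i" "i < n" for i using chain[OF that] by (intro mult_left_mono) auto
  moreover have "real t * m n \<le> real t * 1" using mn by (intro mult_left_mono) auto
  ultimately show "l \<in> ?A"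
    using ext n unfolding lecture_hall_lattice_def lecture_hall_cone_def
    by (simp add: eq)
qed

definition ehrhart_series :: "nat \<Rightarrow> (nat \<Rightarrow> nat) \<Rightarrow> int fps" where
  "ehrhart_series n s = Abs_fps (\<lambda>t. int (ehrhart_count n s t))"

text \<open>
  The power series on the right is a polynomial whenever \<open>n \<ge> 1\<close> and \<open>s 1, \<dots>, s n\<close> are
  positive, and \<open>fps_of_poly\<close> is injective.
\<close>
definition Q_poly :: "nat \<Rightarrow> (nat \<Rightarrow> nat) \<Rightarrow> int poly" where
  "Q_poly n s = (THE p. fps_of_poly p = (1 - fps_X ^ s n) ^ (n + 1) * ehrhart_series n s)"

text \<open>
  \<open>coeffs\<close> lists the coefficients from the constant term up to the leading one, without
  trailing zeros.
\<close>
definition hstar_vector :: "nat \<Rightarrow> (nat \<Rightarrow> nat) \<Rightarrow> int list" where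
  "hstar_vector n s = coeffs (Q_poly n s)"

definition symmetric_list :: "'a list \<Rightarrow> bool" where
  "symmetric_list xs \<longleftrightarrow> rev xs = xs"

end

theory Submission
  imports Defs
begin

text \<open>
  The cone is simplicial, and each of its \<open>n\<close> integral rays ends at height \<open>s n\<close> in the last
  coordinate. Hence the series counting lattice points of the cone by their last coordinate,
  multiplied by \<open>(1 - x ^ s n) ^ n\<close>, is the polynomial \<open>P\<close> counting the points of the half-open
  fundamental parallelepiped, and the numerator of the Ehrhart series is
  \<open>(1 + x + \<dots> + x ^ (s n - 1)) P\<close>; so its symmetry is that of \<open>P\<close>. The same holds for the
  interior of the cone, whose parallelepiped is the reflection of the first one. Therefore symmetry
  means that the series of the interior is \<open>x ^ b\<close> times that of the cone. Comparing cardinalities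
  level by level, this happens iff the interior is the translate of the cone by its unique lowest
  point \<open>c\<close>, and, the facet functionals being primitive by coprimality, iff all of
  them equal \<open>1\<close> at \<open>c\<close>. Such a \<open>c\<close> satisfies \<open>s\<^sub>i\<^sub>-\<^sub>1 c\<^sub>i - s\<^sub>i c\<^sub>i\<^sub>-\<^sub>1 = 1\<close>, which is solvable iff \<open>s\<^sub>i\<close> divides
  \<open>s\<^sub>i\<^sub>+\<^sub>1 + s\<^sub>i\<^sub>-\<^sub>1\<close> for all \<open>i < n\<close>.
\<close>

section \<open>Counting integer points by their last coordinate\<close>

definition level_series :: "nat \<Rightarrow> (nat \<Rightarrow> int) set \<Rightarrow> int fps" where
  "level_series n S = Abs_fps (\<lambda>m. int (card {f \<in> S. f n = int m}))"

lemma level_series_disjoint_union: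
  assumes "S \<inter> T = {}"
    and "\<And>m. finite {f \<in> S. f n = int m}" and "\<And>m. finite {f \<in> T. f n = int m}"
  shows "level_series n (S \<union> T) = level_series n S + level_series n T"
proof (rule fps_ext)
  fix m
  have "{f \<in> S \<union> T. f n = int m} = {f \<in> S. f n = int m} \<union> {f \<in> T. f n = int m}" by blast
  moreover have "{f \<in> S. f n = int m} \<inter> {f \<in> T. f n = int m} = {}" using assms(1) by blast
  ultimately show "level_series n (S \<union> T) $ m = (level_series n S + level_series n T) $ m"
    using assms by (simp add: level_series_def card_Un_disjoint)
qed

text \<open>The series records nonnegative levels only. A point of \<open>S\<close> at a negative
  level could be moved to a level in \<open>{0..<d}\<close>, where the right-hand side has
  coefficient 0; the second assumption excludes this.\<close>

lemma level_series_translate: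
  assumes v: "v n = int d" and S: "\<And>f. f \<in> S \<Longrightarrow> 0 \<le> f n"
  shows "level_series n ((\<lambda>f i. f i + v i) ` S) = fps_X ^ d * level_series n S"
proof (rule fps_ext)
  fix m
  let ?t = "\<lambda>f i. f i + v i :: int"
  have inj: "inj ?t" by (intro injI) (simp add: fun_eq_iff)
  show "level_series n (?t ` S) $ m = (fps_X ^ d * level_series n S) $ m"
  proof (cases "m < d")
    case True
    have "{f \<in> ?t ` S. f n = int m} = {}"
    proof safe
      fix f g assume "g \<in> S" "g n + v n = int m"
      with S[of g] v True show "?t g \<in> {}" by simp
    qed
    with True show ?thesis
      by (simp only: level_series_def fps_X_power_mult_nth fps_nth_Abs_fps) simp
  next
    case False
    have "{f \<in> ?t ` S. f n = int m} = ?t ` {f \<in> S. f n = int (m - d)}"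
      using False v by (auto simp: of_nat_diff)
    hence "card {f \<in> ?t ` S. f n = int m} = card {f \<in> S. f n = int (m - d)}"
      by (simp add: card_image inj_on_subset[OF inj])
    with False show ?thesis
      by (simp add: level_series_def fps_X_power_mult_nth)
  qed
qed

section \<open>The cone, its facet functionals and its rays\<close>

text \<open>
  Prefixing \<open>s 0 = 1\<close> and \<open>f 0 = 0\<close> makes the inequality \<open>0 \<le> f 1\<close> and the first
  recurrence equation of a generated sequence instances of the general ones.
\<close>
locale lecture_hall =
  fixes n :: nat and s :: "nat \<Rightarrow> int"
  assumes n_pos: "1 \<le> n" and s_0: "s 0 = 1" and s_pos: "\<And>i. i \<le> n \<Longrightarrow> 0 < s i"
begin

definition lattice :: "(nat \<Rightarrow> int) set" where
  "lattice = {f. f 0 = 0 \<and> (\<forall>i>n. f i = 0)}"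

text \<open>For \<open>i \<in> {1..n}\<close>, nonnegativity of this functional is the inequality
  between the ratios \<open>f (i - 1) / s (i - 1)\<close> and \<open>f i / s i\<close>, cleared of
  denominators.\<close>

definition facet :: "nat \<Rightarrow> (nat \<Rightarrow> int) \<Rightarrow> int" where
  "facet i f = s (i - 1) * f i - s i * f (i - 1)"

text \<open>
  With \<open>\<theta> = 0\<close> or \<open>\<theta> = 1\<close>, the case \<open>k = 0\<close> gives the lattice points of the cone or of its
  interior; \<open>k = n\<close> gives those of the half-open fundamental parallelepiped
  (for \<open>\<theta> = 1\<close> the opposite faces are removed).
\<close>
definition cone :: "int \<Rightarrow> nat \<Rightarrow> (nat \<Rightarrow> int) set" where
  "cone \<theta> k = {f \<in> lattice. (\<forall>i\<in>{1..n}. \<theta> \<le> facet i f) \<and>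
     (\<forall>i\<in>{1..k}. facet i f < \<theta> + s (i - 1) * s i)}"

text \<open>An integral generator of the cone: the ratio \<open>ray k i / s i\<close> jumps from 0
  to 1 at \<open>i = k\<close>, so facet \<open>k\<close> is the only one that does not vanish on
  it.\<close>

definition ray :: "nat \<Rightarrow> nat \<Rightarrow> int" where
  "ray k i = (if k \<le> i \<and> i \<le> n then s i else 0)"

lemma facet_add: "facet i (\<lambda>j. f j + g j) = facet i f + facet i g"
  by (simp add: facet_def algebra_simps)

lemma facet_diff: "facet i (\<lambda>j. f j - g j) = facet i f - facet i g"
  by (simp add: facet_def algebra_simps)

lemma facet_ray:
  assumes "i \<in> {1..n}" "k \<in> {1..n}"
  shows "facet i (ray k) = (if i = k then s (i - 1) * s i else 0)"
  using assms by (auto simp: facet_def ray_def)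

lemma edge_pos: "i \<in> {1..n} \<Longrightarrow> 0 < s (i - 1) * s i"
  by (intro mult_pos_pos s_pos) auto

lemma cone_nonneg:
  assumes f: "f \<in> cone \<theta> k" and \<theta>: "0 \<le> \<theta>"
  shows "i \<le> n \<Longrightarrow> 0 \<le> f i"
proof (induction i)
  case 0
  show ?case using f by (simp add: cone_def lattice_def)
next
  case (Suc i)
  have "\<theta> \<le> facet (Suc i) f" using f Suc.prems by (auto simp: cone_def)
  moreover have "0 \<le> s (Suc i) * f i"
    using Suc s_pos[of "Suc i"] by (intro mult_nonneg_nonneg) auto
  ultimately have "0 \<le> s i * f (Suc i)" using \<theta> by (simp add: facet_def)
  thus ?case using s_pos[of i] Suc.prems by (simp add: zero_le_mult_iff)
qed

lemma cone_le:
  assumes f: "f \<in> cone \<theta> k" and \<theta>: "0 \<le> \<theta>"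
  shows "i \<le> n \<Longrightarrow> f i * s n \<le> f n * s i"
proof (induction i rule: inc_induct)
  case (step i)
  have pos: "0 < s i" "0 < s (Suc i)" "0 < s n" using s_pos step.hyps by auto
  have "\<theta> \<le> facet (Suc i) f" using f step.hyps by (auto simp: cone_def)
  hence "s (Suc i) * f i * s n \<le> s i * f (Suc i) * s n"
    using \<theta> pos by (intro mult_right_mono) (auto simp: facet_def)
  also have "\<dots> \<le> s i * (f n * s (Suc i))"
    using step.IH pos by (simp add: mult.assoc)
  finally have "s (Suc i) * (f i * s n) \<le> s (Suc i) * (f n * s i)"
    by (simp add: ac_simps)
  thus ?case using pos by simp
qed simp

lemma finite_cone_level:
  assumes "0 \<le> \<theta>"
  shows "finite {f \<in> cone \<theta> k. f n = m}"
proof (rule finite_subset)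
  \<comment> \<open>One bound for all coordinates:
    \<open>f x \<le> f x * s n \<le> f n * s x\<close>, and \<open>s x\<close> is at most the sum of
    all \<open>s j\<close>.\<close>
  let ?B = "{0..\<bar>m\<bar> * (\<Sum>j\<le>n. s j)}"
  show "finite {f. \<forall>x. (x \<in> {..n} \<longrightarrow> f x \<in> ?B) \<and> (x \<notin> {..n} \<longrightarrow> f x = 0)}"
    by (rule finite_set_of_finite_funs) auto
  show "{f \<in> cone \<theta> k. f n = m} \<subseteq> {f. \<forall>x. (x \<in> {..n} \<longrightarrow> f x \<in> ?B) \<and> (x \<notin> {..n} \<longrightarrow> f x = 0)}"
  proof clarify
    fix f x assume f: "f \<in> cone \<theta> k"
    have "f x \<in> {0..\<bar>f n\<bar> * (\<Sum>j\<le>n. s j)}" if x: "x \<le> n"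
    proof -
      have nonneg: "0 \<le> f x" "0 \<le> f n" using cone_nonneg[OF f assms] x by auto
      have "f x * 1 \<le> f x * s n" using nonneg s_pos[of n] by (intro mult_left_mono) auto
      also have "\<dots> \<le> f n * s x" by (rule cone_le[OF f assms x])
      also have "\<dots> \<le> f n * (\<Sum>j\<le>n. s j)"
        using x nonneg s_pos by (intro mult_left_mono member_le_sum) (auto intro: less_imp_le)
      finally show ?thesis using nonneg by simp
    qed
    moreover have "f x = 0" if "x > n" using f that by (auto simp: cone_def lattice_def)
    ultimately show "(x \<in> {..n} \<longrightarrow> f x \<in> {0..\<bar>f n\<bar> * (\<Sum>j\<le>n. s j)}) \<and> (x \<notin> {..n} \<longrightarrow> f x = 0)"
      by auto
  qed
qed

section \<open>From the cone to the fundamental parallelepiped\<close>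

text \<open>\<open>ray (Suc k)\<close> raises facet \<open>Suc k\<close> by
  \<open>s k * s (Suc k)\<close> and fixes the other facets. Hence the points of
  \<open>cone \<theta> k\<close> at or above the threshold \<open>\<theta> + s k * s (Suc k)\<close>
  are exactly the translates, and those below it form \<open>cone \<theta> (Suc k)\<close>.\<close>

lemma cone_step:
  assumes "Suc k \<le> n"
  shows "cone \<theta> k = cone \<theta> (Suc k) \<union> (\<lambda>f i. f i + ray (Suc k) i) ` cone \<theta> k"
    and "cone \<theta> (Suc k) \<inter> (\<lambda>f i. f i + ray (Suc k) i) ` cone \<theta> k = {}"
proof -
  have k: "Suc k \<in> {1..n}" using assms by simp
  have image: "(\<lambda>f i. f i + ray (Suc k) i) ` cone \<theta> k =
    {f \<in> cone \<theta> k. \<theta> + s k * s (Suc k) \<le> facet (Suc k) f}" (is "?L = ?R")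
  proof (intro equalityI subsetI)
    fix h assume "h \<in> ?L"
    then obtain f where f: "f \<in> cone \<theta> k" and h: "h = (\<lambda>i. f i + ray (Suc k) i)" by blast
    have fac: "facet i h = facet i f + (if i = Suc k then s k * s (Suc k) else 0)" if "i \<in> {1..n}" for i
      using that k by (simp add: h facet_add facet_ray)
    have "h \<in> lattice" using f k by (auto simp: h cone_def lattice_def ray_def)
    moreover have "\<theta> \<le> facet i h" if "i \<in> {1..n}" for i
    proof -
      have "\<theta> \<le> facet i f" using f that by (simp add: cone_def)
      thus ?thesis using that edge_pos[OF k] by (cases "i = Suc k") (simp_all add: fac)
    qed
    moreover have "facet i h < \<theta> + s (i - 1) * s i" if "i \<in> {1..k}" for i
      using f that assms by (auto simp: fac cone_def)
    moreover have "\<theta> + s k * s (Suc k) \<le> facet (Suc k) h"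
      using f k by (simp add: fac cone_def)
    ultimately show "h \<in> ?R" by (simp add: cone_def)
  next
    fix h assume h: "h \<in> ?R"
    define f where "f = (\<lambda>i. h i - ray (Suc k) i)"
    have fac: "facet i f = facet i h - (if i = Suc k then s k * s (Suc k) else 0)" if "i \<in> {1..n}" for i
      using that k by (simp add: f_def facet_diff facet_ray)
    have "f \<in> lattice" using h k by (auto simp: f_def cone_def lattice_def ray_def)
    moreover have "\<theta> \<le> facet i f" if "i \<in> {1..n}" for i
      using h that by (auto simp: fac cone_def)
    moreover have "facet i f < \<theta> + s (i - 1) * s i" if "i \<in> {1..k}" for i
      using h that assms by (auto simp: fac cone_def)
    ultimately have "f \<in> cone \<theta> k" by (simp add: cone_def)
    moreover have "h = (\<lambda>i. f i + ray (Suc k) i)" by (simp add: f_def)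
    ultimately show "h \<in> ?L" by blast
  qed
  have less: "cone \<theta> (Suc k) = {f \<in> cone \<theta> k. facet (Suc k) f < \<theta> + s k * s (Suc k)}"
    by (auto simp: cone_def atLeastAtMostSuc_conv)
  show "cone \<theta> k = cone \<theta> (Suc k) \<union> (\<lambda>f i. f i + ray (Suc k) i) ` cone \<theta> k"
    and "cone \<theta> (Suc k) \<inter> (\<lambda>f i. f i + ray (Suc k) i) ` cone \<theta> k = {}"
    unfolding image less by auto
qed

text \<open>Every ray ends at level \<open>s n\<close>, so \<open>cone_step\<close> says that the
  series of \<open>cone \<theta> k\<close> is that of \<open>cone \<theta> (Suc k)\<close> plus
  \<open>x ^ s n\<close> times itself. Each step thus costs one factor
  \<open>1 - x ^ s n\<close>.\<close>

lemma cone_series: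
  assumes \<theta>: "0 \<le> \<theta>"
  shows "k \<le> n \<Longrightarrow>
    (1 - fps_X ^ nat (s n)) ^ k * level_series n (cone \<theta> 0) = level_series n (cone \<theta> k)"
proof (induction k)
  case (Suc k)
  let ?T = "(\<lambda>f i. f i + ray (Suc k) i) ` cone \<theta> k"
  note step = cone_step[OF Suc.prems, of \<theta>]
  have "level_series n (cone \<theta> k) = level_series n (cone \<theta> (Suc k) \<union> ?T)"
    by (simp only: step(1)[symmetric])
  also have "\<dots> = level_series n (cone \<theta> (Suc k)) + level_series n ?T"
  proof (rule level_series_disjoint_union[OF step(2)])
    fix m
    show "finite {f \<in> cone \<theta> (Suc k). f n = int m}" by (rule finite_cone_level[OF \<theta>])
    have "?T \<subseteq> cone \<theta> k" using step(1) by blast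
    thus "finite {f \<in> ?T. f n = int m}"
      by (intro finite_subset[OF _ finite_cone_level[OF \<theta>, of k "int m"]]) auto
  qed
  also have "level_series n ?T = fps_X ^ nat (s n) * level_series n (cone \<theta> k)"
    using Suc.prems s_pos[of n] by (intro level_series_translate cone_nonneg[OF _ \<theta>]) (auto simp: ray_def)
  finally have "level_series n (cone \<theta> k) - fps_X ^ nat (s n) * level_series n (cone \<theta> k) =
      level_series n (cone \<theta> (Suc k))"
    by (rule iffD2[OF diff_eq_eq])
  thus ?case using Suc by (simp add: mult.assoc left_diff_distrib)
qed simp

section \<open>The numerator polynomial and its reflection\<close>

definition num :: "int \<Rightarrow> nat \<Rightarrow> int" where
  "num \<theta> m = int (card {f \<in> cone \<theta> n. f n = int m})"

text \<open>The last coordinate of the sum of all rays; it bounds the levels of both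
  parallelepipeds.\<close>

definition top_level :: nat where
  "top_level = n * nat (s n)"

lemma int_top_level: "int top_level = int n * s n"
  using s_pos[of n] by (simp add: top_level_def)

text \<open>The sum of all rays is the point with coordinates \<open>i * s i\<close>.\<close>
definition reflect_point :: "(nat \<Rightarrow> int) \<Rightarrow> nat \<Rightarrow> int" where
  "reflect_point f i = (if i \<le> n then int i * s i else 0) - f i"

lemma facet_reflect_point:
  assumes "i \<in> {1..n}"
  shows "facet i (reflect_point f) = s (i - 1) * s i - facet i f"
  using assms by (auto simp: facet_def reflect_point_def of_nat_diff algebra_simps)

text \<open>For integers, \<open>0 \<le> a \<and> a < N\<close> is equivalent to
  \<open>1 \<le> N - a \<and> N - a < 1 + N\<close>; apply this to each facet value \<open>a\<close>
  with \<open>N = s (i - 1) * s i\<close>.\<close>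

lemma reflect_point_cone:
  "f \<in> cone 0 n \<Longrightarrow> reflect_point f \<in> cone 1 n" "f \<in> cone 1 n \<Longrightarrow> reflect_point f \<in> cone 0 n"
  by (force simp: cone_def facet_reflect_point lattice_def reflect_point_def)+

lemma reflect_point_involution: "reflect_point (reflect_point f) = f"
  by (simp add: fun_eq_iff reflect_point_def)

lemma cone_le_top_level:
  assumes "\<theta> = 0 \<or> \<theta> = 1" "f \<in> cone \<theta> n"
  shows "f n \<le> int top_level"
proof -
  have "0 \<le> reflect_point f n"
    using assms reflect_point_cone[of f] by (auto intro: cone_nonneg)
  thus ?thesis by (simp add: reflect_point_def int_top_level)
qed

lemma num_above: "\<theta> = 0 \<or> \<theta> = 1 \<Longrightarrow> top_level < m \<Longrightarrow> num \<theta> m = 0"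
proof -
  assume \<theta>: "\<theta> = 0 \<or> \<theta> = 1" and m: "top_level < m"
  have "{f \<in> cone \<theta> n. f n = int m} = {}"
    using cone_le_top_level[OF \<theta>] m by force
  thus ?thesis unfolding num_def by (simp only: card.empty of_nat_0)
qed

lemma num_reflect:
  assumes "m \<le> top_level"
  shows "num 1 m = num 0 (top_level - m)"
proof -
  have "bij_betw reflect_point {f \<in> cone 1 n. f n = int m} {f \<in> cone 0 n. f n = int (top_level - m)}"
    by (rule bij_betw_byWitness[where f' = reflect_point])
      (use assms in \<open>auto simp: reflect_point_involution reflect_point_cone of_nat_diff int_top_level reflect_point_def\<close>)
  thus ?thesis by (simp add: num_def bij_betw_same_card)
qed

definition numerator :: "int \<Rightarrow> int poly" where
  "numerator \<theta> = (\<Sum>m\<le>top_level. monom (num \<theta> m) m)"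

lemma coeff_numerator: "\<theta> = 0 \<or> \<theta> = 1 \<Longrightarrow> coeff (numerator \<theta>) m = num \<theta> m"
  by (auto simp: numerator_def coeff_sum num_above)

lemma numerator_series:
  assumes "\<theta> = 0 \<or> \<theta> = 1"
  shows "fps_of_poly (numerator \<theta>) = (1 - fps_X ^ nat (s n)) ^ n * level_series n (cone \<theta> 0)"
proof -
  have "fps_of_poly (numerator \<theta>) = level_series n (cone \<theta> n)"
    using assms by (intro fps_ext) (simp add: coeff_numerator num_def level_series_def)
  thus ?thesis using assms cone_series[of \<theta> n] by auto
qed

text \<open>All ratios \<open>f i / s i\<close> lie between 0 and the last one. The case
  \<open>k = n\<close> yields the constant term of the numerator, the case \<open>k = 0\<close> the
  uniqueness of the lowest interior point.\<close>

lemma cone_level_0: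
  assumes "k \<le> n"
  shows "{f \<in> cone 0 k. f n = 0} = {\<lambda>_. 0}"
proof (intro equalityI subsetI)
  fix f assume "f \<in> {f \<in> cone 0 k. f n = 0}"
  hence f: "f \<in> cone 0 k" "f n = 0" by auto
  have "f i = 0" for i
  proof (cases "i \<le> n")
    case True
    have "f i * s n \<le> 0" using cone_le[OF f(1) order.refl True] f(2) by simp
    hence "f i \<le> 0" using s_pos[of n] by (simp add: mult_le_0_iff)
    with cone_nonneg[OF f(1) order.refl True] show ?thesis by simp
  qed (use f in \<open>auto simp: cone_def lattice_def\<close>)
  thus "f \<in> {\<lambda>_. 0}" by auto
next
  fix f :: "nat \<Rightarrow> int"
  assume f: "f \<in> {\<lambda>_. 0}"
  have "facet i f = 0" for i using f by (simp add: facet_def)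
  moreover have "0 < s (i - 1) * s i" if "i \<in> {1..k}" for i
    using that assms by (intro edge_pos) auto
  ultimately show "f \<in> {f \<in> cone 0 k. f n = 0}"
    using f by (auto simp: cone_def lattice_def)
qed

text \<open>Reflecting points reverses the coefficients about \<open>top_level\<close>, whereas
  \<open>reflect_poly\<close> reverses them about the degree; the monomial makes up the
  difference.\<close>

lemma numerator_reflect:
  "numerator 1 = monom 1 (top_level - degree (numerator 0)) * reflect_poly (numerator 0)"
proof (rule poly_eqI)
  fix m
  let ?d = "degree (numerator 0)"
  have d: "?d \<le> top_level"
    unfolding numerator_def by (intro degree_sum_le) (auto intro: order.trans[OF degree_monom_le])
  show "coeff (numerator 1) m = coeff (monom 1 (top_level - ?d) * reflect_poly (numerator 0)) m"
  proof (cases "m \<le> top_level")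
    case True
    have "coeff (numerator 1) m = coeff (numerator 0) (top_level - m)"
      using True by (simp add: coeff_numerator num_reflect)
    also have "\<dots> = coeff (monom 1 (top_level - ?d) * reflect_poly (numerator 0)) m"
      using d True by (auto simp: coeff_monom_mult coeff_reflect_poly coeff_eq_0 intro!: arg_cong[where f = "coeff _"])
    finally show ?thesis .
  next
    case False
    thus ?thesis using d by (simp add: coeff_numerator num_above coeff_monom_mult coeff_reflect_poly)
  qed
qed

lemma coeff_0_numerator: "coeff (numerator 0) 0 = 1"
  using cone_level_0[of n] by (simp add: coeff_numerator num_def)

text \<open>Both series become their numerators after multiplication by the same nonzero
  \<open>D\<close>, so a shift between the series is a shift between the numerators.\<close>

lemma reflect_numerator_iff:
  "reflect_poly (numerator 0) = numerator 0 \<longleftrightarrow>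
    (\<exists>b. level_series n (cone 1 0) = fps_X ^ b * level_series n (cone 0 0))"
proof -
  let ?P = "numerator 0"
  define D where "D = (1 - fps_X ^ nat (s n) :: int fps) ^ n"
  define e where "e = top_level - degree ?P"
  have "(1 - fps_X ^ nat (s n) :: int fps) $ 0 = 1" using s_pos[of n] by simp
  hence D: "D \<noteq> 0" unfolding D_def by (metis fps_zero_nth power_not_zero zero_neq_one)
  have num: "fps_of_poly (numerator \<theta>) = D * level_series n (cone \<theta> 0)" if "\<theta> = 0 \<or> \<theta> = 1" for \<theta>
    using numerator_series[OF that] by (simp add: D_def)
  have "level_series n (cone 1 0) = fps_X ^ b * level_series n (cone 0 0) \<longleftrightarrow>
      numerator 1 = monom 1 b * ?P" for b
  proof -
    have "level_series n (cone 1 0) = fps_X ^ b * level_series n (cone 0 0) \<longleftrightarrow>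
        D * level_series n (cone 1 0) = D * (fps_X ^ b * level_series n (cone 0 0))"
      using D by simp
    also have "\<dots> \<longleftrightarrow> fps_of_poly (numerator 1) = fps_of_poly (monom 1 b * ?P)"
      by (simp add: num fps_of_poly_mult fps_of_poly_monom ac_simps)
    finally show ?thesis by (simp only: fps_of_poly_eq_iff)
  qed
  moreover have "reflect_poly ?P = ?P \<longleftrightarrow> (\<exists>b. numerator 1 = monom 1 b * ?P)"
  proof
    assume "reflect_poly ?P = ?P"
    thus "\<exists>b. numerator 1 = monom 1 b * ?P" using numerator_reflect by metis
  next
    assume "\<exists>b. numerator 1 = monom 1 b * ?P"
    then obtain b where b: "monom 1 e * reflect_poly ?P = monom 1 b * ?P"
      using numerator_reflect by (auto simp: e_def)
    have P: "coeff ?P 0 = 1" "coeff (reflect_poly ?P) 0 \<noteq> 0"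
      using coeff_0_numerator by auto
    \<comment> \<open>Compare lowest terms: \<open>?P\<close> and its reflection both have nonzero
      constant coefficient, so the two sides start exactly at \<open>e\<close> and at
      \<open>b\<close>.\<close>
    have "e = b"
    proof (rule linorder_cases[of e b])
      assume "e < b"
      hence "coeff (monom 1 b * ?P) e = 0" by (simp add: coeff_monom_mult)
      moreover have "coeff (monom 1 e * reflect_poly ?P) e \<noteq> 0"
        using P by (simp only: coeff_monom_mult) simp
      ultimately show ?thesis using b by simp
    next
      assume "b < e"
      hence "coeff (monom 1 e * reflect_poly ?P) b = 0" by (simp add: coeff_monom_mult)
      moreover have "coeff (monom 1 b * ?P) b \<noteq> 0"
        using P by (simp only: coeff_monom_mult) simp
      ultimately show ?thesis using b by simp
    qed
    with b show "reflect_poly ?P = ?P" by simp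
  qed
  ultimately show ?thesis by simp
qed

section \<open>Symmetry as a translation of the cone onto its interior\<close>

text \<open>
  Adding a large multiple of a point in the relative interior of a facet to any lattice point
  at height one over that facet gives an interior point of the cone.
\<close>
lemma interior_point_near_facet:
  assumes i: "i \<in> {1..n}" and coprime: "coprime (s (i - 1)) (s i)"
  shows "\<exists>f \<in> cone 1 0. facet i f = 1"
proof -
  \<comment> \<open>Bezout coefficients, to be placed at coordinates \<open>i - 1\<close> and
    \<open>i\<close>. For \<open>i = 1\<close> the lower one sits at index 0, where lattice points
    vanish, so it must be 0.\<close>
  obtain x y where xy: "s (i - 1) * y - s i * x = 1" "i = 1 \<longrightarrow> x = 0"
  proof (cases "i = 1")
    case True
    thus ?thesis using that[of 1 0] s_0 by simp
  next
    case False
    obtain u v where "u * s (i - 1) + v * s i = gcd (s (i - 1)) (s i)"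
      using bezout_int by blast
    thus ?thesis using that[of u "- v"] False coprime by (simp add: algebra_simps)
  qed
  define g where "g j = (if j = i then y else if j = i - 1 then x else 0)" for j
  \<comment> \<open>The sum of all rays except \<open>ray i\<close>: facet \<open>i\<close> vanishes
    on it and every other facet is positive.\<close>
  define w where "w j = (if j > n then 0 else int (if i \<le> j then j - 1 else j) * s j)" for j
  \<comment> \<open>Large enough that \<open>facet j g + K \<ge> 1\<close> for every
    \<open>j \<in> {1..n}\<close>.\<close>
  define K where "K = 1 + (\<Sum>j=1..n. \<bar>facet j g\<bar>)"
  define f where "f j = g j + K * w j" for j
  have fac_f: "facet j f = facet j g + K * facet j w" for j
    by (simp add: f_def facet_def algebra_simps)
  have fac_g: "facet i g = 1" using i xy by (auto simp: facet_def g_def)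
  have fac_w: "facet j w = (if j = i then 0 else s (j - 1) * s j)" if "j \<in> {1..n}" for j
  proof -
    obtain k where k: "j = Suc k" using \<open>j \<in> {1..n}\<close> by (cases j) auto
    show ?thesis using that i unfolding k
      by (cases "i \<le> k"; cases k) (auto simp: facet_def w_def of_nat_diff algebra_simps)
  qed
  have "1 \<le> facet j f" if j: "j \<in> {1..n}" for j
  proof (cases "j = i")
    case True
    thus ?thesis using i by (simp add: fac_f fac_g fac_w)
  next
    case False
    have "\<bar>facet j g\<bar> \<le> (\<Sum>j=1..n. \<bar>facet j g\<bar>)"
      using j by (intro member_le_sum) auto
    hence K: "1 \<le> facet j g + K" "0 \<le> K" by (auto simp: K_def intro: sum_nonneg)
    have "K * 1 \<le> K * (s (j - 1) * s j)" using K edge_pos[OF j] by (intro mult_left_mono) auto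
    with K False j show ?thesis by (simp add: fac_f fac_w)
  qed
  moreover have "f \<in> lattice" using i xy by (auto simp: lattice_def f_def g_def w_def)
  ultimately have "f \<in> cone 1 0" by (simp add: cone_def)
  moreover have "facet i f = 1" using i by (simp add: fac_f fac_g fac_w)
  ultimately show ?thesis by blast
qed

text \<open>Adding \<open>c\<close> raises every facet value by exactly 1, which turns the bound 0
  into the bound 1.\<close>

lemma translate_cone:
  assumes "c \<in> lattice" "\<And>i. i \<in> {1..n} \<Longrightarrow> facet i c = 1"
  shows "cone 1 0 = (\<lambda>f i. f i + c i) ` cone 0 0"
proof (intro equalityI subsetI)
  fix f assume f: "f \<in> cone 1 0"
  have "(\<lambda>i. f i - c i) \<in> cone 0 0"
    using f assms by (auto simp: cone_def lattice_def facet_diff)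
  thus "f \<in> (\<lambda>f i. f i + c i) ` cone 0 0" by (rule image_eqI[rotated]) simp
next
  fix f assume "f \<in> (\<lambda>f i. f i + c i) ` cone 0 0"
  thus "f \<in> cone 1 0" using assms by (auto simp: cone_def lattice_def facet_add)
qed

lemma series_shift_iff:
  assumes coprime: "\<And>i. i \<in> {1..n} \<Longrightarrow> coprime (s (i - 1)) (s i)"
  shows "(\<exists>b. level_series n (cone 1 0) = fps_X ^ b * level_series n (cone 0 0)) \<longleftrightarrow>
    (\<exists>c\<in>lattice. \<forall>i\<in>{1..n}. facet i c = 1)"
proof
  assume "\<exists>c\<in>lattice. \<forall>i\<in>{1..n}. facet i c = 1"
  then obtain c where c: "c \<in> lattice" "\<And>i. i \<in> {1..n} \<Longrightarrow> facet i c = 1" by blast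
  hence "c \<in> cone 1 0" by (simp add: cone_def)
  hence "0 \<le> c n" by (rule cone_nonneg) auto
  have "cone 1 0 = (\<lambda>f i. f i + c i) ` cone 0 0" by (rule translate_cone) (use c in auto)
  moreover have "level_series n ((\<lambda>f i. f i + c i) ` cone 0 0) =
      fps_X ^ nat (c n) * level_series n (cone 0 0)"
    by (rule level_series_translate) (use \<open>0 \<le> c n\<close> in \<open>auto intro: cone_nonneg\<close>)
  ultimately show "\<exists>b. level_series n (cone 1 0) = fps_X ^ b * level_series n (cone 0 0)" by metis
next
  let ?L = "\<lambda>\<theta> m. {f \<in> cone \<theta> 0. f n = int m}"
  assume "\<exists>b. level_series n (cone 1 0) = fps_X ^ b * level_series n (cone 0 0)"
  then obtain b where b: "level_series n (cone 1 0) = fps_X ^ b * level_series n (cone 0 0)" ..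
  have card: "card (?L 1 m) = (if m < b then 0 else card (?L 0 (m - b)))" for m
    using arg_cong[OF b, of "\<lambda>F. F $ m"]
    by (simp add: level_series_def fps_X_power_mult_nth split: if_splits)
  \<comment> \<open>Level \<open>b\<close> of the interior has as many points as level 0 of the
    cone, which is just the origin.\<close>
  have "card (?L 1 b) = 1" using card[of b] cone_level_0[of 0] by simp
  then obtain c where "?L 1 b = {c}" by (auto simp: card_1_singleton_iff)
  hence c: "c \<in> cone 1 0" "c n = int b" by auto
  have below: "facet i c \<le> facet i f" if f: "f \<in> cone 1 0" and i: "i \<in> {1..n}" for f i
  proof -
    define m where "m = nat (f n)"
    have m: "f n = int m" using cone_nonneg[OF f, of n] by (simp add: m_def)
    have fin: "finite (?L 1 m)" by (rule finite_cone_level) simp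
    have "f \<in> ?L 1 m" using f m by simp
    hence "card (?L 1 m) \<noteq> 0" using fin by auto
    hence mb: "b \<le> m" and eq: "card (?L 1 m) = card (?L 0 (m - b))"
      using card[of m] by (auto split: if_splits)
    let ?t = "\<lambda>f i. f i + c i :: int"
    \<comment> \<open>Translation by \<open>c\<close> injects a level of the cone into a level of
      the interior. These are finite of equal size, so it is onto, and \<open>f\<close> exceeds
      \<open>c\<close> by a point of the cone.\<close>
    have "?t ` ?L 0 (m - b) \<subseteq> ?L 1 m"
      using c mb by (force simp: cone_def lattice_def facet_add)
    moreover have "card (?t ` ?L 0 (m - b)) = card (?L 1 m)"
      unfolding eq by (intro card_image inj_onI) (simp add: fun_eq_iff)
    ultimately have "?t ` ?L 0 (m - b) = ?L 1 m" using fin by (intro card_subset_eq)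
    with \<open>f \<in> ?L 1 m\<close> obtain g where "g \<in> cone 0 0" "f = ?t g" by blast
    thus ?thesis using i by (simp add: facet_add cone_def)
  qed
  \<comment> \<open>\<open>c\<close> minimizes every facet over the interior, and some interior
    point attains the value 1 on facet \<open>i\<close>.\<close>
  have "facet i c = 1" if i: "i \<in> {1..n}" for i
  proof -
    obtain f where "f \<in> cone 1 0" "facet i f = 1"
      using interior_point_near_facet[OF i coprime[OF i]] by blast
    hence "facet i c \<le> 1" using below i by fastforce
    moreover have "1 \<le> facet i c" using c i by (simp add: cone_def)
    ultimately show ?thesis by simp
  qed
  moreover have "c \<in> lattice" using c by (simp add: cone_def)
  ultimately show "\<exists>c\<in>lattice. \<forall>i\<in>{1..n}. facet i c = 1" by blast
qed

end

section \<open>Solving the facet equations\<close>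

text \<open>The solution with initial values 0 and 1 of the recurrence that a generated
  \<open>s\<close> satisfies with initial values 1 and \<open>s 1\<close>.\<close>

fun continuant :: "(nat \<Rightarrow> int) \<Rightarrow> nat \<Rightarrow> int" where
  "continuant u 0 = 0"
| "continuant u (Suc 0) = 1"
| "continuant u (Suc (Suc i)) = u (Suc i) * continuant u (Suc i) - continuant u i"

context lecture_hall
begin

text \<open>\<open>facet\<close> is the 2 by 2 determinant of consecutive values of \<open>s\<close>
  and \<open>c\<close>. If it is constantly 1, divisibility yields \<open>u\<close>; conversely, two
  solutions of the same recurrence have constant determinant.\<close>

lemma facet_one_iff:
  "(\<exists>c\<in>lattice. \<forall>i\<in>{1..n}. facet i c = 1) \<longleftrightarrow>
    (\<exists>u. \<forall>i. 1 \<le> i \<and> i < n \<longrightarrow> 0 < u i \<and> s (i + 1) = u i * s i - s (i - 1))"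
proof
  assume "\<exists>c\<in>lattice. \<forall>i\<in>{1..n}. facet i c = 1"
  then obtain c where c: "\<And>i. i \<in> {1..n} \<Longrightarrow> facet i c = 1" by blast
  define u where "u i = (s (i + 1) + s (i - 1)) div s i" for i
  have "0 < u i \<and> s (i + 1) = u i * s i - s (i - 1)" if i: "1 \<le> i" "i < n" for i
  proof -
    have eqs: "s (i - 1) * c i - s i * c (i - 1) = 1" "s i * c (i + 1) - s (i + 1) * c i = 1"
      using c[of i] c[of "i + 1"] i by (auto simp: facet_def)
    have "coprime (s i) (c i)"
    proof (rule coprimeI)
      fix d assume "d dvd s i" "d dvd c i"
      hence "d dvd s (i - 1) * c i - s i * c (i - 1)" by (intro dvd_diff dvd_mult dvd_mult2)
      thus "is_unit d" using eqs by simp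
    qed
    \<comment> \<open>Both left-hand sides in \<open>eqs\<close> equal 1; equate them and collect
      the terms with \<open>c i\<close> and with \<open>s i\<close>.\<close>
    moreover have "c i * (s (i + 1) + s (i - 1)) = s i * (c (i + 1) + c (i - 1))"
      using eqs by (simp add: algebra_simps)
    ultimately have "s i dvd s (i + 1) + s (i - 1)"
      by (metis coprime_dvd_mult_right_iff dvd_triv_left)
    hence u: "u i * s i = s (i + 1) + s (i - 1)" by (simp add: u_def)
    have pos: "0 < s (i - 1)" "0 < s i" "0 < s (i + 1)" using s_pos i by auto
    hence "0 < u i * s i" using u by simp
    hence "0 < u i" using pos(2) by (rule zero_less_mult_pos2)
    thus ?thesis using u by simp
  qed
  thus "\<exists>u. \<forall>i. 1 \<le> i \<and> i < n \<longrightarrow> 0 < u i \<and> s (i + 1) = u i * s i - s (i - 1)" by blast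
next
  assume "\<exists>u. \<forall>i. 1 \<le> i \<and> i < n \<longrightarrow> 0 < u i \<and> s (i + 1) = u i * s i - s (i - 1)"
  then obtain u where u: "\<And>i. 1 \<le> i \<Longrightarrow> i < n \<Longrightarrow> s (i + 1) = u i * s i - s (i - 1)" by blast
  define c where "c i = (if i \<le> n then continuant u i else 0)" for i
  \<comment> \<open>The determinant is 1 at the start because \<open>s 0 = 1\<close>, and the
    recurrence preserves it.\<close>
  have "s i * continuant u (Suc i) - s (Suc i) * continuant u i = 1" if "i < n" for i
    using that
  proof (induction i)
    case 0
    show ?case by (simp add: s_0)
  next
    case (Suc i)
    have eq: "s (Suc (Suc i)) = u (Suc i) * s (Suc i) - s i" using u[of "Suc i"] Suc.prems by simp
    show ?case using Suc by (simp add: eq algebra_simps)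
  qed
  hence "facet (Suc i) c = 1" if "i < n" for i
    using that by (simp add: facet_def c_def)
  hence "facet i c = 1" if "i \<in> {1..n}" for i using that by (cases i) auto
  moreover have "c \<in> lattice" by (simp add: lattice_def c_def)
  ultimately show "\<exists>c\<in>lattice. \<forall>i\<in>{1..n}. facet i c = 1" by blast
qed

end

section \<open>Palindromic polynomials and the coefficient list\<close>

lemma reflect_poly_geometric:
  "reflect_poly (\<Sum>j<m. monom (1 :: int) j) = (\<Sum>j<m. monom 1 j)"
proof (cases m)
  case (Suc k)
  define G where "G = (\<Sum>j<m. monom (1 :: int) j)"
  have coeff: "coeff G i = (if i \<le> k then 1 else 0)" for i by (auto simp: G_def coeff_sum Suc)
  have "degree G = k"
    using coeff by (intro antisym degree_le le_degree) auto
  hence "reflect_poly G = G"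
    by (intro poly_eqI) (auto simp: coeff_reflect_poly coeff)
  thus ?thesis by (simp add: G_def)
qed simp

text \<open>\<open>reflect_poly\<close> drops the low-order zero coefficients before reversing; a
  nonzero constant term means that none are dropped.\<close>

lemma symmetric_list_coeffs_iff:
  assumes "coeff p 0 \<noteq> 0"
  shows "symmetric_list (coeffs p) \<longleftrightarrow> reflect_poly p = p"
proof -
  have "coeffs p \<noteq> [] \<and> hd (coeffs p) \<noteq> 0" using assms by (cases p) (auto simp: cCons_def)
  hence "dropWhile ((=) 0) (coeffs p) = coeffs p" by (cases "coeffs p") auto
  thus ?thesis by (simp add: symmetric_list_def coeffs_eq_iff coeffs_reflect_poly)
qed

text \<open>Resolves the definite description: uniqueness is injectivity of
  \<open>fps_of_poly\<close>.\<close>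

lemma Q_poly_eqI:
  assumes "fps_of_poly p = (1 - fps_X ^ s n) ^ (n + 1) * ehrhart_series n s"
  shows "Q_poly n s = p"
  unfolding Q_poly_def
proof (rule the_equality)
  show "q = p" if "fps_of_poly q = (1 - fps_X ^ s n) ^ (n + 1) * ehrhart_series n s" for q
    using that assms by (metis fps_of_poly_eq_iff)
qed (rule assms)

section \<open>Real lattice points and the Ehrhart series\<close>

lemma bij_betw_lattice_points:
  fixes s :: "nat \<Rightarrow> nat"
  defines "s' \<equiv> \<lambda>i. if i = 0 then 1 else int (s i)"
  assumes n: "1 \<le> n" and s: "\<And>i. 1 \<le> i \<Longrightarrow> i \<le> n \<Longrightarrow> s i > 0"
  shows "bij_betw (\<lambda>f. restrict (\<lambda>i. real_of_int (f i)) {1..n})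
    (lecture_hall.cone n s' 0 0) (lecture_hall_lattice n s)"
proof -
  interpret L: lecture_hall n s'
    by unfold_locales (use n s in \<open>auto simp: s'_def\<close>)
  let ?r = "\<lambda>f. restrict (\<lambda>i. real_of_int (f i)) {1..n} :: nat \<Rightarrow> real"
  have cone_iff: "?r f \<in> lecture_hall_lattice n s \<longleftrightarrow> f \<in> L.cone 0 0" if f: "f \<in> L.lattice" for f
  proof -
    have step: "real_of_int (f i) / s i \<le> real_of_int (f (i + 1)) / s (i + 1) \<longleftrightarrow> 0 \<le> L.facet (i + 1) f"
      if i: "1 \<le> i" "i < n" for i
    proof -
      have "real_of_int (f i) / s i \<le> real_of_int (f (i + 1)) / s (i + 1) \<longleftrightarrow>
          real_of_int (s (i + 1) * f i) \<le> real_of_int (s i * f (i + 1))"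
        using s[of i] s[of "i + 1"] i by (simp add: field_simps)
      also have "\<dots> \<longleftrightarrow> 0 \<le> L.facet (i + 1) f"
        using i unfolding of_int_le_iff L.facet_def by (simp add: s'_def)
      finally show ?thesis .
    qed
    have first: "0 \<le> real_of_int (f 1) / s 1 \<longleftrightarrow> 0 \<le> L.facet 1 f"
      unfolding L.facet_def using n s[of 1] f by (simp add: s'_def L.lattice_def zero_le_divide_iff)
    have "?r f \<in> lecture_hall_lattice n s \<longleftrightarrow> 0 \<le> real_of_int (f 1) / s 1 \<and>
        (\<forall>i. 1 \<le> i \<and> i < n \<longrightarrow> real_of_int (f i) / s i \<le> real_of_int (f (i + 1)) / s (i + 1))"
      using n by (simp add: lecture_hall_lattice_def lecture_hall_cone_def)
    also have "\<dots> \<longleftrightarrow> 0 \<le> L.facet 1 f \<and> (\<forall>i. 1 \<le> i \<and> i < n \<longrightarrow> 0 \<le> L.facet (i + 1) f)"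
      using first step by blast
    also have "\<dots> \<longleftrightarrow> (\<forall>i\<in>{1..n}. 0 \<le> L.facet i f)"
    proof safe
      fix i assume *: "0 \<le> L.facet 1 f" "\<forall>i. 1 \<le> i \<and> i < n \<longrightarrow> 0 \<le> L.facet (i + 1) f" "i \<in> {1..n}"
      show "0 \<le> L.facet i f"
      proof (cases "i = 1")
        case False
        hence "1 \<le> i - 1 \<and> i - 1 < n" "i - 1 + 1 = i" using *(3) by auto
        thus ?thesis using *(2) by metis
      qed (use * in simp)
    qed (use n in auto)
    finally show ?thesis using f by (simp add: L.cone_def)
  qed
  show ?thesis
    unfolding bij_betw_def
  proof (intro conjI inj_onI equalityI subsetI)
    fix f g assume fg: "f \<in> L.cone 0 0" "g \<in> L.cone 0 0" "?r f = ?r g"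
    show "f = g"
    proof
      fix i
      show "f i = g i"
        using fg(1,2) fun_cong[OF fg(3), of i] by (cases "i \<in> {1..n}"; cases "i = 0") (auto simp: L.cone_def L.lattice_def)
    qed
  next
    fix l assume "l \<in> ?r ` L.cone 0 0"
    then obtain f where f: "f \<in> L.cone 0 0" "l = ?r f" by blast
    hence "f \<in> L.lattice" by (simp add: L.cone_def)
    with f cone_iff show "l \<in> lecture_hall_lattice n s" by simp
  next
    fix l assume l: "l \<in> lecture_hall_lattice n s"
    \<comment> \<open>The floor recovers the integer behind each real coordinate; the default 0 is
      what \<open>L.lattice\<close> demands outside \<open>{1..n}\<close>.\<close>
    define f where "f i = (if i \<in> {1..n} then \<lfloor>l i\<rfloor> else 0)" for i
    have ext: "l \<in> {1..n} \<rightarrow>\<^sub>E \<int>" using l by (simp add: lecture_hall_lattice_def)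
    have lr: "l = ?r f"
    proof
      fix i
      show "l i = ?r f i"
      proof (cases "i \<in> {1..n}")
        case True
        hence "l i \<in> \<int>" using ext by (rule PiE_mem[rotated])
        thus ?thesis using True by (auto simp: f_def elim: Ints_cases)
      next
        case False
        thus ?thesis using PiE_arb[OF ext] by (simp only: restrict_apply if_False)
      qed
    qed
    have "f \<in> L.lattice" by (simp add: L.lattice_def f_def)
    with l lr cone_iff have "f \<in> L.cone 0 0" by simp
    with lr show "l \<in> ?r ` L.cone 0 0" by blast
  qed
qed

text \<open>Ehrhart counts are partial sums of the level counts, and multiplication by
  \<open>1 - fps_X\<close> takes first differences.\<close>

lemma ehrhart_series_eq:
  fixes s :: "nat \<Rightarrow> nat"
  defines "s' \<equiv> \<lambda>i. if i = 0 then 1 else int (s i)"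
  assumes n: "1 \<le> n" and s: "\<And>i. 1 \<le> i \<Longrightarrow> i \<le> n \<Longrightarrow> s i > 0"
  shows "(1 - fps_X) * ehrhart_series n s = level_series n (lecture_hall.cone n s' 0 0)"
proof -
  interpret L: lecture_hall n s'
    by unfold_locales (use n s in \<open>auto simp: s'_def\<close>)
  let ?r = "\<lambda>f. restrict (\<lambda>i. real_of_int (f i)) {1..n} :: nat \<Rightarrow> real"
  let ?U = "\<lambda>t. {f \<in> L.cone 0 0. f n \<le> int t}" and ?E = "\<lambda>t. {f \<in> L.cone 0 0. f n = int t}"
  have bij: "bij_betw ?r (L.cone 0 0) (lecture_hall_lattice n s)"
    unfolding s'_def by (rule bij_betw_lattice_points[OF n s])
  have count: "ehrhart_count n s t = card (?U t)" for t
  proof -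
    have image: "?r ` ?U t = {l \<in> lecture_hall_lattice n s. l n \<le> real t}"
      unfolding bij_betw_imp_surj_on[OF bij, symmetric] using n by auto
    have inj: "inj_on ?r (?U t)"
      by (rule inj_on_subset[OF bij_betw_imp_inj_on[OF bij]]) auto
    show ?thesis unfolding ehrhart_count_def image[symmetric] by (rule card_image[OF inj])
  qed
  have fin: "finite (?E t)" for t by (rule L.finite_cone_level) simp
  have U0: "?U 0 = ?E 0" using L.cone_nonneg[of _ 0 0 n] by force
  have USuc: "?U (Suc t) = ?U t \<union> ?E (Suc t)" for t by auto
  have finU: "finite (?U t)" for t
  proof (induction t)
    case 0
    show ?case unfolding U0 by (rule fin)
  next
    case (Suc t)
    show ?case unfolding USuc by (rule finite_UnI[OF Suc fin])
  qed
  show ?thesis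
  proof (rule fps_ext)
    fix t
    show "((1 - fps_X) * ehrhart_series n s) $ t = level_series n (L.cone 0 0) $ t"
    proof (cases t)
      case 0
      thus ?thesis by (simp add: ehrhart_series_def level_series_def count left_diff_distrib U0[simplified])
    next
      case (Suc k)
      have "card (?U (Suc k)) = card (?U k) + card (?E (Suc k))"
        unfolding USuc by (rule card_Un_disjoint[OF finU fin]) auto
      thus ?thesis using Suc
        by (simp add: ehrhart_series_def level_series_def count left_diff_distrib)
    qed
  qed
qed

section \<open>Factoring the numerator and assembling the equivalence\<close>

theorem theorem4p3:
  fixes n :: nat and s :: "nat \<Rightarrow> nat"
  assumes "n \<ge> 1"
    and "\<And>i. 1 \<le> i \<Longrightarrow> i \<le> n \<Longrightarrow> s i > 0"
    and "\<And>i. 1 \<le> i \<Longrightarrow> i < n \<Longrightarrow> gcd (s i) (s (i + 1)) = 1"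
  shows "symmetric_list (hstar_vector n s) \<longleftrightarrow> (\<exists>u :: nat \<Rightarrow> nat. u_generated n s u)"
proof -
  define s' where "s' i = (if i = 0 then 1 else int (s i))" for i
  have s'_eq: "s' = (\<lambda>i. if i = 0 then 1 else int (s i))" by (simp add: fun_eq_iff s'_def)
  interpret L: lecture_hall n s'
    by unfold_locales (use assms in \<open>auto simp: s'_def\<close>)
  have sn: "nat (s' n) = s n" "0 < s n" using assms(1,2) by (auto simp: s'_def)
  \<comment> \<open>The quotient of \<open>1 - x ^ s n\<close> by \<open>1 - x\<close>. It accounts
    for both the exponent \<open>n + 1\<close> in place of \<open>n\<close> and the cumulative
    counts.\<close>
  define G :: "int poly" where "G = (\<Sum>j<s n. monom 1 j)"
  let ?P = "L.numerator 0" 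
  define D :: "int fps" where "D = 1 - fps_X ^ s n"
  have "fps_of_poly G = (\<Sum>j<s n. fps_X ^ j)"
    by (simp add: G_def fps_of_poly_sum fps_of_poly_monom)
  hence G: "(1 - fps_X) * fps_of_poly G = D" by (simp add: D_def one_diff_power_eq)
  have "(1 - fps_X) * ehrhart_series n s = level_series n (L.cone 0 0)"
    unfolding s'_eq by (rule ehrhart_series_eq) (use assms in auto)
  hence P: "fps_of_poly ?P = D ^ n * ((1 - fps_X) * ehrhart_series n s)"
    using L.numerator_series[of 0] by (simp add: D_def sn)
  have "(1 - fps_X) * fps_of_poly (G * ?P) = D * (D ^ n * ((1 - fps_X) * ehrhart_series n s))"
    unfolding fps_of_poly_mult P G[symmetric] by (simp only: mult.assoc)
  hence "(1 - fps_X) * fps_of_poly (G * ?P) = (1 - fps_X) * (D ^ (n + 1) * ehrhart_series n s)"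
    by (simp add: ac_simps)
  moreover have "1 - fps_X \<noteq> (0 :: int fps)" by (metis fps_X_neq_one right_minus_eq)
  ultimately have "fps_of_poly (G * ?P) = D ^ (n + 1) * ehrhart_series n s"
    by (simp only: mult_cancel_left) simp
  hence Q: "Q_poly n s = G * ?P" unfolding D_def by (rule Q_poly_eqI)
  have "coeff G 0 = 1" using sn by (simp add: G_def coeff_sum)
  hence "coeff (G * ?P) 0 = 1" "G \<noteq> 0" using L.coeff_0_numerator by (auto simp: coeff_mult_0)
  \<comment> \<open>Reflection is multiplicative and fixes \<open>G\<close>, so \<open>G\<close> can
    be cancelled afterwards.\<close>
  hence "symmetric_list (hstar_vector n s) \<longleftrightarrow> G * reflect_poly ?P = G * ?P"
    by (simp add: hstar_vector_def Q symmetric_list_coeffs_iff reflect_poly_mult G_def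
        reflect_poly_geometric)
  also have "\<dots> \<longleftrightarrow> reflect_poly ?P = ?P" using \<open>G \<noteq> 0\<close> by simp
  also have "\<dots> \<longleftrightarrow>
      (\<exists>u. \<forall>i. 1 \<le> i \<and> i < n \<longrightarrow> 0 < u i \<and> s' (i + 1) = u i * s' i - s' (i - 1))"
  proof -
    have "coprime (s' (i - 1)) (s' i)" if "i \<in> {1..n}" for i
    proof (cases "i = 1")
      case False
      hence "1 \<le> i - 1" "i - 1 < n" "i - 1 + 1 = i" using that by auto
      hence "gcd (s (i - 1)) (s i) = 1" using assms(3) by metis
      thus ?thesis using False that by (simp add: s'_def coprime_iff_gcd_eq_1)
    qed (simp add: s'_def)
    thus ?thesis
      by (simp only: L.reflect_numerator_iff L.series_shift_iff L.facet_one_iff)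
  qed
  also have "\<dots> \<longleftrightarrow> (\<exists>u :: nat \<Rightarrow> nat. u_generated n s u)"
  proof
    assume "\<exists>u. \<forall>i. 1 \<le> i \<and> i < n \<longrightarrow> 0 < u i \<and> s' (i + 1) = u i * s' i - s' (i - 1)"
    then obtain u where u: "\<And>i. 1 \<le> i \<Longrightarrow> i < n \<Longrightarrow> 0 < u i \<and> s' (i + 1) = u i * s' i - s' (i - 1)"
      by blast
    \<comment> \<open>Positivity of \<open>u i\<close> makes \<open>nat\<close> lossless, and
      \<open>s' 0 = 1\<close> supplies the \<open>- 1\<close> in the first equation.\<close>
    have "u_generated n s (\<lambda>i. nat (u i))"
      unfolding u_generated_def
    proof (intro conjI allI impI)
      assume "1 < n"
      thus "int (s 2) = int (nat (u 1)) * int (s 1) - 1"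
        using u[of 1] by (simp add: s'_def numeral_2_eq_2)
    next
      fix i assume "1 < i \<and> i < n"
      thus "int (s (i + 1)) = int (nat (u i)) * int (s i) - int (s (i - 1))"
        using u[of i] by (simp add: s'_def)
    qed (use u in auto)
    thus "\<exists>u :: nat \<Rightarrow> nat. u_generated n s u" by blast
  next
    assume "\<exists>u :: nat \<Rightarrow> nat. u_generated n s u"
    then obtain u where u: "u_generated n s u" ..
    have "0 < int (u i) \<and> s' (i + 1) = int (u i) * s' i - s' (i - 1)" if "1 \<le> i" "i < n" for i
      using u that by (cases "i = 1") (auto simp: u_generated_def s'_def numeral_2_eq_2)
    thus "\<exists>u. \<forall>i. 1 \<le> i \<and> i < n \<longrightarrow> 0 < u i \<and> s' (i + 1) = u i * s' i - s' (i - 1)"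
      by (intro exI[of _ "\<lambda>i. int (u i)"]) blast
  qed
  finally show ?thesis .
qed

end
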